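(* Let $X\subset\mathbb P^2$ be a non-singular plane quartic over $\mathbb C$ with a hyper-flex point $\infty\in X$. Let $D$ and $D'$ be effective divisors of degree $3$ on $X$. Let $C$ be a cubic and $E^-$ an effective divisor of degree $3$ such that $C\cdot X=D+D'+E^-+3\infty$, and let $A_{E^-}$ be a conic and $E$ an effective divisor of degree $3$ such that $A_{E^-}\cdot X=E^-+E+2\infty$. Then, in $JX$, $$(D-3\infty)+(D'-3\infty)\equiv E-3\infty .$$
   Context: The ground field is $\mathbb C$. A hyper-flex point is a point $p\in X$ whose tangent line meets $X$ with multiplicity $4$ at $p$. $JX$ is the Jacobian of $X$, every element of which is the class of a divisor of the form $D-3\infty$ with $D$ effective of degree $3$. $\equiv$ denotes linear equivalence of divisors on $X$, and $C\cdot X$ denotes the divisor cut out on $X$ by the plane curve $C$. *)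

theory Defs
  imports
    "HOL-Analysis.Analysis"
    "HOL-Computational_Algebra.Polynomial"
    "HOL-Algebra.Free_Abelian_Groups"
begin

section \<open>Ternary forms\<close>

text \<open>
  The ring \<open>\<complex>[x,y,z]\<close> is the nested type \<open>\<complex>[x][y][z]\<close>: the coefficient of
  \<open>x^i y^j z^k\<close> in \<open>F\<close> is \<open>coeff (coeff (coeff F k) j) i\<close>.
\<close>

type_synonym poly3 = "complex poly poly poly"

definition varX :: poly3 where "varX = [:[:[:0, 1:]:]:]"
definition varY :: poly3 where "varY = [:[:0, 1:]:]"
definition varZ :: poly3 where "varZ = [:0, 1:]"

definition const3 :: "complex \<Rightarrow> poly3" where "const3 c = [:[:[:c:]:]:]"

definition eval3 :: "poly3 \<Rightarrow> complex ^ 3 \<Rightarrow> complex" where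
  "eval3 F v = poly (poly (poly F [:[:v $ 3:]:]) [:v $ 2:]) (v $ 1)"

definition dX :: "poly3 \<Rightarrow> poly3" where "dX F = map_poly (map_poly pderiv) F"
definition dY :: "poly3 \<Rightarrow> poly3" where "dY F = map_poly pderiv F"
definition dZ :: "poly3 \<Rightarrow> poly3" where "dZ F = pderiv F"

definition homogeneous :: "nat \<Rightarrow> poly3 \<Rightarrow> bool" where
  "homogeneous d F \<longleftrightarrow>
     (\<forall>i j k. poly.coeff (poly.coeff (poly.coeff F k) j) i \<noteq> 0 \<longrightarrow> i + j + k = d)"

definition plane_curve :: "nat \<Rightarrow> poly3 \<Rightarrow> bool" where
  "plane_curve d F \<longleftrightarrow> F \<noteq> 0 \<and> homogeneous d F"

definition nonsingular :: "poly3 \<Rightarrow> bool" where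
  "nonsingular F \<longleftrightarrow>
     (\<forall>v. v \<noteq> 0 \<longrightarrow> eval3 F v = 0 \<longrightarrow>
        \<not> (eval3 (dX F) v = 0 \<and> eval3 (dY F) v = 0 \<and> eval3 (dZ F) v = 0))"

section \<open>Points of the projective plane\<close>

text \<open>A point of the projective plane is the set of all its homogeneous coordinate vectors.\<close>

type_synonym pt = "(complex ^ 3) set"

definition proj_pt :: "complex ^ 3 \<Rightarrow> pt" where
  "proj_pt v = {c *s v | c. c \<noteq> 0}"

definition P2 :: "pt set" where
  "P2 = {proj_pt v | v. v \<noteq> 0}"

definition curve_pts :: "poly3 \<Rightarrow> pt set" where
  "curve_pts F = {P \<in> P2. \<forall>v\<in>P. eval3 F v = 0}"

section \<open>Orders of vanishing along a curve\<close>

definition pt_ideal :: "pt \<Rightarrow> poly3 set" where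
  "pt_ideal P = {G. \<forall>v\<in>P. eval3 G v = 0}"

primrec ideal_pow :: "poly3 set \<Rightarrow> nat \<Rightarrow> poly3 set" where
  "ideal_pow I 0 = UNIV"
| "ideal_pow I (Suc n) = module.span (*) {a * b | a b. a \<in> I \<and> b \<in> ideal_pow I n}"

text \<open>
  Let \<open>X\<close> be the curve \<open>F = 0\<close>, \<open>P \<in> X\<close>, \<open>m\<close> the maximal ideal of the local ring
  \<open>O\<^sub>X\<^sub>,\<^sub>P\<close>, and \<open>G\<close> a form of degree \<open>d\<close>; choose a linear form \<open>L\<close> with \<open>L(P) \<noteq> 0\<close>.
  The predicate says that the germ of \<open>G / L^d\<close> lies in \<open>m^n\<close>.  Since
  \<open>O\<^sub>X\<^sub>,\<^sub>P\<close> is the degree-0 part of the localization of \<open>\<complex>[x,y,z]/(F)\<close> at the forms not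
  vanishing at \<open>P\<close>, this means \<open>H G \<in> I(P)^n + (F)\<close> for some such form \<open>H\<close>.
\<close>

definition vanishes_to_order :: "poly3 \<Rightarrow> pt \<Rightarrow> poly3 \<Rightarrow> nat \<Rightarrow> bool" where
  "vanishes_to_order F P G n \<longleftrightarrow>
     (\<exists>e H A B. homogeneous e H \<and> (\<forall>v\<in>P. eval3 H v \<noteq> 0) \<and>
        A \<in> ideal_pow (pt_ideal P) n \<and> H * G = A + B * F)"

text \<open>
  At a non-singular point this is the discrete valuation of \<open>O\<^sub>X\<^sub>,\<^sub>P\<close>, i.e. the
  intersection multiplicity at \<open>P\<close> of \<open>X\<close> with the curve \<open>G = 0\<close>.
\<close>

definition ord_at :: "poly3 \<Rightarrow> pt \<Rightarrow> poly3 \<Rightarrow> enat" where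
  "ord_at F P G = Sup {enat n | n. vanishes_to_order F P G n}"

definition tangent_line :: "poly3 \<Rightarrow> complex ^ 3 \<Rightarrow> poly3" where
  "tangent_line F v =
     const3 (eval3 (dX F) v) * varX + const3 (eval3 (dY F) v) * varY
     + const3 (eval3 (dZ F) v) * varZ"

definition hyperflex :: "poly3 \<Rightarrow> pt \<Rightarrow> bool" where
  "hyperflex F P \<longleftrightarrow>
     P \<in> curve_pts F \<and> (\<forall>v\<in>P. ord_at F P (tangent_line F v) = 4)"

section \<open>Divisors\<close>

type_synonym divisor = "pt \<Rightarrow>\<^sub>0 int"

abbreviation Div :: "poly3 \<Rightarrow> divisor monoid" where
  "Div F \<equiv> free_Abelian_group (curve_pts F)"

definition div_degree :: "divisor \<Rightarrow> int" where
  "div_degree D = (\<Sum>P\<in>Poly_Mapping.keys D. Poly_Mapping.lookup D P)"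

definition effective :: "poly3 \<Rightarrow> divisor \<Rightarrow> bool" where
  "effective F D \<longleftrightarrow> D \<in> carrier (Div F) \<and> (\<forall>P. 0 \<le> Poly_Mapping.lookup D P)"

text \<open>
  \<open>cuts_out F G \<Delta>\<close> states \<open>G \<cdot> X = \<Delta>\<close>.  It determines \<open>\<Delta>\<close>, and it fails for every \<open>\<Delta>\<close>
  when \<open>G = 0\<close> contains \<open>X\<close>, all orders then being infinite.
\<close>

definition cuts_out :: "poly3 \<Rightarrow> poly3 \<Rightarrow> divisor \<Rightarrow> bool" where
  "cuts_out F G \<Delta> \<longleftrightarrow> effective F \<Delta> \<and>
     (\<forall>P\<in>curve_pts F. ord_at F P G = enat (nat (Poly_Mapping.lookup \<Delta> P)))"

text \<open>
  A nonzero rational function on \<open>X\<close> is a quotient \<open>G / H\<close> of two forms of the same degree,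
  neither of them divisible by \<open>F\<close>; its divisor is \<open>G \<cdot> X - H \<cdot> X\<close>.
\<close>

definition principal_divisors :: "poly3 \<Rightarrow> divisor set" where
  "principal_divisors F =
     {\<Delta> - \<Delta>' | \<Delta> \<Delta>'. \<exists>d G H. homogeneous d G \<and> homogeneous d H \<and>
        \<not> F dvd G \<and> \<not> F dvd H \<and> cuts_out F G \<Delta> \<and> cuts_out F H \<Delta>'}"

definition lin_equiv :: "poly3 \<Rightarrow> divisor \<Rightarrow> divisor \<Rightarrow> bool" where
  "lin_equiv F D D' \<longleftrightarrow>
     D \<in> carrier (Div F) \<and> D' \<in> carrier (Div F) \<and> D - D' \<in> principal_divisors F"

section \<open>The Jacobian\<close>

definition Div0 :: "poly3 \<Rightarrow> divisor monoid" where
  "Div0 F = (Div F)\<lparr>carrier := {D \<in> carrier (Div F). div_degree D = 0}\<rparr>"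

definition jacobian :: "poly3 \<Rightarrow> divisor set monoid" where
  "jacobian F = Div0 F Mod principal_divisors F"

definition jac_class :: "poly3 \<Rightarrow> divisor \<Rightarrow> divisor set" where
  "jac_class F D = principal_divisors F #>\<^bsub>Div0 F\<^esub> D"

end

theory Submission
  imports Defs
begin

text \<open>
  The tangent line \<open>L\<close> at the hyper-flex point cuts out \<open>4\<infinity>\<close>, so the rational function
  \<open>C / (A L)\<close> has divisor
  \<open>(D + D' + E\<^sup>- + 3\<infinity>) - (E\<^sup>- + E + 2\<infinity>) - 4\<infinity> = (D - 3\<infinity>) + (D' - 3\<infinity>) - (E - 3\<infinity>)\<close>.
  This uses that the order of vanishing is additive on products. At a non-singular point the
  maximal ideal is generated, modulo \<open>F\<close>, by one linear form \<open>T\<close>; a form \<open>G\<close> of finite order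
  \<open>n\<close> satisfies \<open>H G = T\<^sup>n K + B F\<close> with \<open>H\<close> and \<open>K\<close> not vanishing at the point, and such
  relations can be multiplied.
\<close>

section \<open>Forms and ring homomorphisms\<close>

text \<open>Indexing the coordinates by the type \<open>3\<close> treats all affine charts at once:
  later statements fix an arbitrary enumeration \<open>i\<close>, \<open>j\<close>, \<open>k\<close>
  of the indices.\<close>

definition var :: "3 \<Rightarrow> poly3" where
  "var i = (if i = 1 then varX else if i = 2 then varY else varZ)"

definition dvar :: "3 \<Rightarrow> poly3 \<Rightarrow> poly3" where
  "dvar i = (if i = 1 then dX else if i = 2 then dY else dZ)"

lemma var_simps [simp]: "var 1 = varX" "var 2 = varY" "var 3 = varZ"
  by (auto simp: var_def)

lemma dvar_simps [simp]: "dvar 1 = dX" "dvar 2 = dY" "dvar 3 = dZ"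
  by (auto simp: dvar_def)

lemma coeff_monomial3:
  "poly.coeff (poly.coeff (poly.coeff (const3 c * varX ^ i * varY ^ j * varZ ^ k) k') j') i' =
     (if i' = i \<and> j' = j \<and> k' = k then c else 0)"
proof -
  have "[:[:a:]:] ^ n = [:[:a ^ n:]:]" for a :: complex and n
    by (induction n) (auto simp: one_pCons)
  have pow: "[:q:] ^ n = [:q ^ n:]" for q :: "'a::comm_ring_1" and n
    by (induction n) (auto simp: one_pCons)
  have "varZ ^ k = monom 1 k"
    by (simp add: varZ_def monom_altdef)
  moreover have "varY ^ j = [:monom 1 j:]"
    by (simp add: varY_def monom_altdef pow)
  moreover have "varX ^ i = [:[:monom 1 i:]:]"
    by (simp add: varX_def monom_altdef pow)
  ultimately show ?thesis
    by (auto simp: const3_def smult_monom)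
qed

lemma poly3_expand:
  "F = (\<Sum>k\<le>degree F. \<Sum>j\<le>degree (poly.coeff F k). \<Sum>i\<le>degree (poly.coeff (poly.coeff F k) j).
      const3 (poly.coeff (poly.coeff (poly.coeff F k) j) i) * varX ^ i * varY ^ j * varZ ^ k)"
    (is "F = ?G")
proof -
  have "poly.coeff (poly.coeff (poly.coeff ?G k') j') i' = poly.coeff (poly.coeff (poly.coeff F k') j') i'"
    for i' j' k'
  proof -
    \<comment> \<open>Nesting the three conditions lets each of the three sums collapse
      separately.\<close>
    have *: "(if i' = i \<and> j' = j \<and> k' = k then c else 0) =
        (if k' = k then if j' = j then if i' = i then c else 0 else 0 else 0)" for i j k and c :: complex
      by simp
    have if_sum: "(\<Sum>x\<in>A. if b then f x else 0) = (if b then \<Sum>x\<in>A. f x else 0)"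
      for A and b and f :: "nat \<Rightarrow> complex"
      by simp
    show ?thesis
      by (simp add: coeff_sum coeff_monomial3 * if_sum sum.delta' coeff_eq_0 not_le)
  qed
  then show ?thesis
    by (intro poly_eqI) metis
qed

text \<open>Only monomials that occur in \<open>F\<close> have to be treated, so a constraint on the
  exponents of \<open>F\<close>, such as homogeneity, is available in the monomial case.\<close>

lemma poly3_induct [case_names zero add monomial]:
  assumes zero: "P 0" and add: "\<And>G H. P G \<Longrightarrow> P H \<Longrightarrow> P (G + H)"
    and monomial: "\<And>i j k c. c = poly.coeff (poly.coeff (poly.coeff F k) j) i \<Longrightarrow> c \<noteq> 0 \<Longrightarrow>
      P (const3 c * varX ^ i * varY ^ j * varZ ^ k)"
  shows "P F"
proof -
  have P_sum: "P (sum f A)" if "\<And>x. x \<in> A \<Longrightarrow> P (f x)" for f :: "nat \<Rightarrow> poly3" and A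
    using that by (induction A rule: infinite_finite_induct) (auto intro: zero add)
  have "P (const3 c * varX ^ i * varY ^ j * varZ ^ k)"
    if "c = poly.coeff (poly.coeff (poly.coeff F k) j) i" for i j k c
    using that monomial zero by (cases "c = 0") (auto simp: const3_def)
  then show ?thesis
    by (subst poly3_expand) (auto intro!: P_sum)
qed

lemma homogeneous_0 [simp]: "homogeneous d 0"
  by (simp add: homogeneous_def)

lemma homogeneous_add:
  assumes "homogeneous d F" "homogeneous d G"
  shows "homogeneous d (F + G)"
  using assms unfolding homogeneous_def by (metis add_0 coeff_add)

lemma homogeneous_monomial:
  "i + j + k = d \<Longrightarrow> homogeneous d (const3 c * varX ^ i * varY ^ j * varZ ^ k)"
  by (simp add: homogeneous_def coeff_monomial3)

lemma homogeneous_induct [consumes 1, case_names zero add monomial]: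
  assumes "homogeneous d F"
    and "P 0" "\<And>G H. P G \<Longrightarrow> P H \<Longrightarrow> P (G + H)"
    and "\<And>i j k c. i + j + k = d \<Longrightarrow> P (const3 c * varX ^ i * varY ^ j * varZ ^ k)"
  shows "P F"
  by (rule poly3_induct) (use assms in \<open>auto simp: homogeneous_def\<close>)

lemma const3_mult: "const3 (a * b) = const3 a * const3 b"
  by (simp add: const3_def)

lemma const3_add: "const3 (a + b) = const3 a + const3 b"
  by (simp add: const3_def)

lemma const3_0 [simp]: "const3 0 = 0"
  by (simp add: const3_def)

lemma const3_1 [simp]: "const3 1 = 1"
  by (simp add: const3_def one_pCons)

lemma homogeneous_mult:
  assumes "homogeneous d F" "homogeneous e G"
  shows "homogeneous (d + e) (F * G)"
  using assms(1)
proof (induction rule: homogeneous_induct)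
  case (monomial i j k a)
  show ?case
    using assms(2)
  proof (induction rule: homogeneous_induct)
    case (monomial i' j' k' b)
    have "const3 a * varX ^ i * varY ^ j * varZ ^ k * (const3 b * varX ^ i' * varY ^ j' * varZ ^ k') =
      const3 (a * b) * varX ^ (i + i') * varY ^ (j + j') * varZ ^ (k + k')"
      by (simp add: const3_mult power_add mult_ac)
    moreover have "(i + i') + (j + j') + (k + k') = d + e"
      using monomial \<open>i + j + k = d\<close> by simp
    ultimately show ?case
      using homogeneous_monomial by metis
  qed (auto simp: ring_distribs homogeneous_add)
qed (auto simp: ring_distribs homogeneous_add)

lemma homogeneous_const3 [simp]: "homogeneous 0 (const3 c)"
  using homogeneous_monomial[of 0 0 0 0 c] by simp

lemma homogeneous_1 [simp]: "homogeneous 0 1"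
  using homogeneous_const3[of 1] by simp

lemma homogeneous_const3_mult: "homogeneous d G \<Longrightarrow> homogeneous d (const3 c * G)"
  using homogeneous_mult[OF homogeneous_const3] by fastforce

lemma homogeneous_var [simp]: "homogeneous 1 (var i)"
  using homogeneous_monomial[of 1 0 0 1 1] homogeneous_monomial[of 0 1 0 1 1]
    homogeneous_monomial[of 0 0 1 1 1]
  by (auto simp: var_def)

lemma homogeneous_uminus: "homogeneous d G \<Longrightarrow> homogeneous d (- G)"
  by (simp add: homogeneous_def)

lemma homogeneous_diff: "homogeneous d G \<Longrightarrow> homogeneous d H \<Longrightarrow> homogeneous d (G - H)"
  using homogeneous_add[OF _ homogeneous_uminus] by (metis diff_conv_add_uminus)

lemma homogeneous_power: "homogeneous d G \<Longrightarrow> homogeneous (n * d) (G ^ n)"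
  by (induction n) (auto intro: homogeneous_mult)

section \<open>Ring homomorphisms and substitution into ternary polynomials\<close>

locale ring_map =
  fixes f :: "'a::comm_ring_1 \<Rightarrow> 'b::comm_ring_1"
  assumes map_1 [simp]: "f 1 = 1"
    and map_add [simp]: "f (x + y) = f x + f y"
    and map_mult [simp]: "f (x * y) = f x * f y"
begin

lemma map_0 [simp]: "f 0 = 0"
  using map_add[of 0 0] by simp

lemma map_uminus [simp]: "f (- x) = - f x"
  using map_add[of x "- x"] by (simp add: eq_neg_iff_add_eq_0 add.commute)

lemma map_diff [simp]: "f (x - y) = f x - f y"
  using map_add[of x "- y"] by simp

lemma map_power [simp]: "f (x ^ n) = f x ^ n"
  by (induction n) auto

lemma ring_map_eval: "ring_map (\<lambda>p. poly (map_poly f p) a)"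
proof
  have add: "map_poly f (p + q) = map_poly f p + map_poly f q" for p q
    by (rule poly_eqI) (simp add: coeff_map_poly)
  have smult: "map_poly f (smult c p) = smult (f c) (map_poly f p)" for c p
    by (rule poly_eqI) (simp add: coeff_map_poly)
  show "poly (map_poly f (p + q)) a = poly (map_poly f p) a + poly (map_poly f q) a" for p q
    by (simp add: add)
  show "poly (map_poly f (p * q)) a = poly (map_poly f p) a * poly (map_poly f q) a" for p q
    by (induction p) (auto simp: add smult map_poly_pCons algebra_simps)
qed simp

end

text \<open>Existence in the universal property of the polynomial ring in three variables: the three
  nested layers are evaluated one after another. It supplies the substitutions of local coordinates
  and of a parametrised line.\<close>

lemma ring_map_poly3_exists:
  assumes "ring_map h"
  shows "\<exists>f. ring_map f \<and> (\<forall>c. f (const3 c) = h c) \<and> (\<forall>i. f (var i) = a i)"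
proof -
  define f where "f = (\<lambda>G. poly (map_poly (\<lambda>q. poly (map_poly (\<lambda>r. poly (map_poly h r) (a 1)) q) (a 2)) G) (a 3))"
  have "ring_map f"
    unfolding f_def by (intro ring_map.ring_map_eval assms)
  moreover have "f (const3 c) = h c" for c
    using ring_map.map_0[OF assms]
    by (simp add: f_def const3_def map_poly_pCons)
  moreover have "f (var i) = a i" for i
    using ring_map.map_0[OF assms] ring_map.map_1[OF assms] exhaust_3[of i]
    by (auto simp: f_def varX_def varY_def varZ_def map_poly_pCons)
  ultimately show ?thesis
    by blast
qed

text \<open>Uniqueness in the same universal property. It identifies a substitution followed by
  setting the parameters to 0 with evaluation at a point.\<close>

lemma ring_map_poly3_unique:
  assumes "ring_map f" "ring_map g" "\<And>c. f (const3 c) = g (const3 c)" "\<And>i. f (var i) = g (var i)"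
  shows "f G = g G"
proof -
  interpret f: ring_map f by fact
  interpret g: ring_map g by fact
  have "f varX = g varX" "f varY = g varY" "f varZ = g varZ"
    using assms(4)[of 1] assms(4)[of 2] assms(4)[of 3] by simp_all
  then show ?thesis
    by (induction G rule: poly3_induct) (auto simp: assms(3))
qed

lemma ring_map_eval3: "ring_map (\<lambda>G. eval3 G v)"
  by standard (simp_all add: eval3_def)

lemmas eval3_simps [simp] =
  ring_map.map_0[OF ring_map_eval3] ring_map.map_1[OF ring_map_eval3]
  ring_map.map_add[OF ring_map_eval3] ring_map.map_mult[OF ring_map_eval3]
  ring_map.map_uminus[OF ring_map_eval3] ring_map.map_diff[OF ring_map_eval3]
  ring_map.map_power[OF ring_map_eval3]

lemma eval3_const3 [simp]: "eval3 (const3 c) v = c"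
  by (simp add: eval3_def const3_def)

lemma eval3_var [simp]: "eval3 (var i) v = v $ i"
  using exhaust_3[of i] by (auto simp: eval3_def varX_def varY_def varZ_def)

lemma eval3_varXYZ [simp]: "eval3 varX v = v $ 1" "eval3 varY v = v $ 2" "eval3 varZ v = v $ 3"
  using eval3_var[of 1 v] eval3_var[of 2 v] eval3_var[of 3 v] by simp_all

lemma eval3_scale:
  assumes "homogeneous d G"
  shows "eval3 G (c *s v) = c ^ d * eval3 G v"
  using assms
proof (induction rule: homogeneous_induct)
  case (monomial i j k a)
  then show ?case
    by (auto simp: power_mult_distrib power_add)
qed (auto simp: ring_distribs)

section \<open>Partial derivatives as derivations\<close>

lemma map_poly_additive:
  fixes D :: "'a::comm_ring_1 \<Rightarrow> 'a"
  assumes "\<And>a b. D (a + b) = D a + D b"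
  shows "map_poly D (p + q) = map_poly D p + map_poly D q"
proof -
  have "D 0 = 0"
    using assms[of 0 0] by simp
  then show ?thesis
    by (intro poly_eqI) (simp add: coeff_map_poly assms)
qed

text \<open>\<open>dX\<close> and \<open>dY\<close> act on coefficients of nested polynomials, so
  their Leibniz rule is lifted from \<open>pderiv\<close> through \<open>map_poly\<close>, once for
  \<open>dY\<close> and twice for \<open>dX\<close>.\<close>

lemma map_poly_derivation:
  assumes D: "\<And>a b :: 'a::comm_ring_1. D (a + b) = D a + D b" "\<And>a b. D (a * b) = D a * b + a * D b"
  shows "map_poly D (p * q) = map_poly D p * q + p * map_poly D q"
proof -
  have D0: "D 0 = 0"
    using D(1)[of 0 0] by simp
  have smult: "map_poly D (smult c q) = smult (D c) q + smult c (map_poly D q)" for c q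
    by (rule poly_eqI) (simp add: coeff_map_poly D0 D)
  show ?thesis
    by (induction p) (auto simp: map_poly_additive[OF D(1)] smult map_poly_pCons D0 algebra_simps)
qed

lemma dvar_add [simp]: "dvar i (F + G) = dvar i F + dvar i G"
  using exhaust_3[of i] by (auto simp: dX_def dY_def dZ_def pderiv_add map_poly_additive)

lemma dvar_diff: "dvar i (F - G) = dvar i F - dvar i G"
  using dvar_add[of i "F - G" G] by (simp del: dvar_add)

lemma dvar_mult [simp]: "dvar i (F * G) = dvar i F * G + F * dvar i G"
proof -
  have leibniz: "pderiv (p * q) = pderiv p * q + p * pderiv q" for p q :: "'a::idom poly"
    by (simp add: pderiv_mult algebra_simps)
  show ?thesis
    using exhaust_3[of i]
    by (auto simp: dX_def dY_def dZ_def leibniz pderiv_add map_poly_additive map_poly_derivation)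
qed

lemma dvar_const3 [simp]: "dvar i (const3 c) = 0"
  using exhaust_3[of i] by (auto simp: dX_def dY_def dZ_def const3_def map_poly_pCons pderiv_pCons)

lemma dvar_var [simp]: "dvar i (var j) = (if i = j then 1 else 0)"
  using exhaust_3[of i] exhaust_3[of j]
  by (auto simp: dX_def dY_def dZ_def varX_def varY_def varZ_def map_poly_pCons pderiv_pCons one_pCons)

section \<open>Linear forms through a point\<close>

text \<open>The 2 by 2 minors of the matrix with rows the coordinates and \<open>v\<close>. If
  \<open>v $ k\<close> is nonzero, the two minors pairing \<open>k\<close> with the other indices
  cut out the point \<open>v\<close>.\<close>

definition lin :: "complex ^ 3 \<Rightarrow> 3 \<Rightarrow> 3 \<Rightarrow> poly3" where
  "lin v i k = const3 (v $ k) * var i - const3 (v $ i) * var k"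

lemma homogeneous_lin [simp]: "homogeneous 1 (lin v i k)"
  unfolding lin_def by (intro homogeneous_diff homogeneous_const3_mult homogeneous_var)

lemma eval3_lin [simp]: "eval3 (lin v i k) w = v $ k * w $ i - v $ i * w $ k"
  by (simp add: lin_def)

lemma var_mod_lin:
  assumes "v $ k \<noteq> 0"
  shows "var l = const3 (1 / v $ k) * lin v l k + const3 (v $ l / v $ k) * var k"
proof -
  have "const3 (1 / v $ k) * lin v l k =
      const3 (1 / v $ k * v $ k) * var l - const3 (v $ l / v $ k) * var k"
    by (simp add: lin_def right_diff_distrib flip: const3_mult mult.assoc)
  also have "const3 (1 / v $ k * v $ k) = 1"
    using assms by simp
  finally show ?thesis
    by simp
qed

text \<open>The clause for \<open>d = 0\<close> accounts for the truncated subtraction \<open>0 - 1 = 0\<close>.\<close>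

definition form_below :: "nat \<Rightarrow> poly3 \<Rightarrow> bool" where
  "form_below d a \<longleftrightarrow> (if d = 0 then a = 0 else homogeneous (d - 1) a)"

lemma form_below_0 [simp]: "form_below d 0"
  by (simp add: form_below_def)

lemma form_below_add: "form_below d a \<Longrightarrow> form_below d b \<Longrightarrow> form_below d (a + b)"
  by (auto simp: form_below_def homogeneous_add split: if_splits)

lemma form_below_Suc [simp]: "form_below (Suc d) a \<longleftrightarrow> homogeneous d a"
  by (simp add: form_below_def)

lemma form_below_mult: "form_below d a \<Longrightarrow> homogeneous 1 l \<Longrightarrow> homogeneous d (a * l)"
  using homogeneous_mult[of "d - 1" a 1 l] by (cases d) (auto simp: form_below_def)

text \<open>Modulo the two linear forms every variable is a scalar multiple of \<open>var k\<close>,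
  so a monomial of degree \<open>d\<close> reduces to a multiple of \<open>var k ^ d\<close>.
  Monomials are built up one variable at a time to keep track of the degrees of the
  coefficients.\<close>

lemma form_mod_lin:
  assumes ijk: "UNIV = {i, j, k}" and vk: "v $ k \<noteq> 0" and "homogeneous d G"
  shows "\<exists>a b c. form_below d a \<and> form_below d b \<and>
    G = a * lin v i k + b * lin v j k + const3 c * var k ^ d"
    (is "?Q d G")
  using assms(3)
proof (induction rule: homogeneous_induct)
  case zero
  have "0 = 0 * lin v i k + 0 * lin v j k + const3 0 * var k ^ d"
    by simp
  then show ?case
    using form_below_0 by blast
next
  case (add G H)
  obtain a b c a' b' c' where
    ab: "form_below d a" "form_below d b" "form_below d a'" "form_below d b'"
    and "G = a * lin v i k + b * lin v j k + const3 c * var k ^ d"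
      "H = a' * lin v i k + b' * lin v j k + const3 c' * var k ^ d"
    using add by blast
  then have "G + H = (a + a') * lin v i k + (b + b') * lin v j k + const3 (c + c') * var k ^ d"
    by (simp add: const3_add algebra_simps)
  then show ?case
    using ab form_below_add by blast
next
  case (monomial i' j' k' c)
  have "const3 c = 0 * lin v i k + 0 * lin v j k + const3 c * var k ^ 0"
    by simp
  then have const: "?Q 0 (const3 c)"
    using form_below_0 by blast
  \<comment> \<open>By \<open>var_mod_lin\<close>, multiplication by \<open>var l\<close> leaves a
    multiple of \<open>lin v l k * G\<close>, which is absorbed into the first or second coefficient
    if \<open>l\<close> is \<open>i\<close> or \<open>j\<close>, and is zero if
    \<open>l = k\<close>.\<close>
  have step: "?Q (Suc d) (var l * G)" if Q: "?Q d G" for d l G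
  proof -
    define \<gamma> where "\<gamma> = v $ l / v $ k"
    define \<alpha> \<beta> where "\<alpha> = const3 (1 / v $ k)" and "\<beta> = const3 \<gamma>"
    obtain a b c where
      ab: "form_below d a" "form_below d b"
      and G: "G = a * lin v i k + b * lin v j k + const3 c * var k ^ d"
      using Q by blast
    have hom: "homogeneous d (var k * a)" "homogeneous d (var k * b)"
      using ab form_below_mult[OF _ homogeneous_var] by (metis mult.commute)+
    have homG: "homogeneous d G"
    proof -
      have "homogeneous d (a * lin v i k)" "homogeneous d (b * lin v j k)"
        using ab form_below_mult[OF _ homogeneous_lin] by blast+
      moreover have "homogeneous d (const3 c * var k ^ d)"
        using homogeneous_const3_mult[OF homogeneous_power[OF homogeneous_var, of d k]] by simp
      ultimately show ?thesis
        unfolding G by (intro homogeneous_add)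
    qed
    have "var l * G = \<alpha> * lin v l k * G + \<beta> * var k * G"
      by (subst var_mod_lin[OF vk, of l]) (simp add: \<alpha>_def \<beta>_def \<gamma>_def algebra_simps)
    also have "\<beta> * var k * G = \<beta> * (var k * a) * lin v i k + \<beta> * (var k * b) * lin v j k
        + const3 (\<gamma> * c) * var k ^ Suc d"
      by (simp add: G \<beta>_def const3_mult algebra_simps)
    finally have *: "var l * G = \<alpha> * lin v l k * G + \<beta> * (var k * a) * lin v i k
        + \<beta> * (var k * b) * lin v j k + const3 (\<gamma> * c) * var k ^ Suc d"
      by (simp add: algebra_simps)
    have hom': "homogeneous d (\<alpha> * G)" "homogeneous d (\<beta> * (var k * a))" "homogeneous d (\<beta> * (var k * b))"
      unfolding \<alpha>_def \<beta>_def using homG hom by (auto intro: homogeneous_const3_mult)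
    have "l \<in> {i, j, k}"
      using ijk by auto
    then consider "l = i" | "l = j" | "l = k"
      by auto
    then show ?thesis
    proof cases
      case 1
      then have "var l * G = (\<alpha> * G + \<beta> * (var k * a)) * lin v i k
        + \<beta> * (var k * b) * lin v j k + const3 (\<gamma> * c) * var k ^ Suc d"
        using * by (simp add: algebra_simps)
      then show ?thesis
        using hom' homogeneous_add[OF hom'(1,2)] form_below_Suc by blast
    next
      case 2
      then have "var l * G = \<beta> * (var k * a) * lin v i k
        + (\<alpha> * G + \<beta> * (var k * b)) * lin v j k + const3 (\<gamma> * c) * var k ^ Suc d"
        using * by (simp add: algebra_simps)
      then show ?thesis
        using hom' homogeneous_add[OF hom'(1,3)] form_below_Suc by blast
    next
      case 3
      then have "var l * G = \<beta> * (var k * a) * lin v i k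
        + \<beta> * (var k * b) * lin v j k + const3 (\<gamma> * c) * var k ^ Suc d"
        using * by (simp add: lin_def)
      then show ?thesis
        using hom' form_below_Suc by blast
    qed
  qed
  have steps: "?Q (n + m) (var l ^ n * G)" if "?Q m G" for n m l G
  proof (induction n)
    case (Suc n)
    show ?case
      using step[OF Suc, of l] by (simp only: power_Suc add_Suc mult.assoc)
  qed (use that in simp)
  have "?Q (k' + (j' + (i' + 0))) (var 3 ^ k' * (var 2 ^ j' * (var 1 ^ i' * const3 c)))"
    by (rule steps[OF steps[OF steps[OF const]]])
  moreover have "k' + (j' + (i' + 0)) = d"
    using monomial by simp
  moreover have "var 3 ^ k' * (var 2 ^ j' * (var 1 ^ i' * const3 c)) = const3 c * varX ^ i' * varY ^ j' * varZ ^ k'"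
    by (simp only: mult_ac var_simps)
  ultimately show ?case
    by (simp only:)
qed

text \<open>Both linear forms vanish at \<open>v\<close>, so evaluating the normal form there leaves
  \<open>c * (v $ k) ^ d\<close>, which forces \<open>c = 0\<close>.\<close>

lemma form_in_lin_ideal:
  assumes "UNIV = {i, j, k}" "v $ k \<noteq> 0" "homogeneous d G" "eval3 G v = 0"
  shows "\<exists>a b. homogeneous (d - 1) a \<and> homogeneous (d - 1) b \<and> G = a * lin v i k + b * lin v j k"
proof -
  obtain a b c where
    ab: "form_below d a" "form_below d b"
    and G: "G = a * lin v i k + b * lin v j k + const3 c * var k ^ d"
    using form_mod_lin[OF assms(1-3)] by blast
  have "c = 0"
    using assms(2,4) unfolding G by simp
  with G have "G = a * lin v i k + b * lin v j k"
    by simp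
  moreover have "homogeneous (d - 1) a \<and> homogeneous (d - 1) b"
    using ab by (auto simp: form_below_def split: if_splits)
  ultimately show ?thesis
    by blast
qed

lemma ring_map_const3: "ring_map const3"
  by standard (simp_all add: const3_add const3_mult)

text \<open>Elements of \<open>pt_ideal\<close> need not be homogeneous, so the remainder modulo the
  linear forms is a polynomial \<open>q\<close> in \<open>var k\<close> alone. Vanishing at all
  representatives of the point gives \<open>q\<close> infinitely many roots.\<close>

lemma pt_ideal_in_lin_ideal:
  assumes ijk: "UNIV = {i, j, k}" and vk: "v $ k \<noteq> 0" and G: "G \<in> pt_ideal (proj_pt v)"
  shows "\<exists>a b. G = a * lin v i k + b * lin v j k"
proof -
  define \<phi> where "\<phi> q = poly (map_poly const3 q) (var k)" for q
  interpret \<phi>: ring_map \<phi>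
    unfolding \<phi>_def by (rule ring_map.ring_map_eval[OF ring_map_const3])
  have \<phi>_eval: "eval3 (\<phi> q) w = poly q (w $ k)" for q w
    unfolding \<phi>_def by (induction q) (auto simp: map_poly_pCons)
  have "\<exists>a b q. G = a * lin v i k + b * lin v j k + \<phi> q"
  proof (induction G rule: poly3_induct)
    case zero
    show ?case
      by (rule exI[of _ 0], rule exI[of _ 0], rule exI[of _ 0]) simp
  next
    case (add G H)
    then obtain a b q a' b' q' where
      "G = a * lin v i k + b * lin v j k + \<phi> q" "H = a' * lin v i k + b' * lin v j k + \<phi> q'"
      by blast
    then have "G + H = (a + a') * lin v i k + (b + b') * lin v j k + \<phi> (q + q')"
      by (simp add: algebra_simps)
    then show ?case
      by blast
  next
    case (monomial i' j' k' c)
    obtain a b c' where "const3 c * varX ^ i' * varY ^ j' * varZ ^ k' =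
        a * lin v i k + b * lin v j k + const3 c' * var k ^ (i' + j' + k')"
      using form_mod_lin[OF ijk vk homogeneous_monomial[OF refl, of i' j' k' c]] by blast
    moreover have "const3 c' * var k ^ (i' + j' + k') = \<phi> (monom c' (i' + j' + k'))"
      by (simp add: \<phi>_def map_poly_monom poly_monom)
    ultimately show ?case
      by metis
  qed
  then obtain a b q where q: "G = a * lin v i k + b * lin v j k + \<phi> q"
    by blast
  have "poly q x = 0" if "x \<noteq> 0" for x
  proof -
    have "(x / v $ k) *s v \<in> proj_pt v"
      using that vk by (auto simp: proj_pt_def)
    then have "eval3 G ((x / v $ k) *s v) = 0"
      using G by (auto simp: pt_ideal_def)
    then show ?thesis
      using vk unfolding q by (simp add: \<phi>_eval)
  qed
  then have "- {0} \<subseteq> {x. poly q x = 0}"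
    by auto
  moreover have "infinite (- {0 :: complex})"
    using infinite_UNIV_char_0 by (simp add: Compl_eq_Diff_UNIV)
  ultimately have "q = 0"
    using poly_roots_finite finite_subset by blast
  with q show ?thesis
    by auto
qed

section \<open>The valuation at a non-singular point\<close>

lemma module_poly3: "module ((*) :: poly3 \<Rightarrow> poly3 \<Rightarrow> poly3)"
  by standard (simp_all add: algebra_simps)

lemma ideal_pow_mult: "a \<in> ideal_pow I n \<Longrightarrow> r * a \<in> ideal_pow I n"
  by (cases n) (auto intro: module.span_scale[OF module_poly3])

lemma power_in_ideal_pow: "a \<in> I \<Longrightarrow> a ^ n \<in> ideal_pow I n"
  by (induction n) (auto intro!: module.span_base[OF module_poly3])

lemma proj_pt_self: "v \<in> proj_pt v"
  unfolding proj_pt_def by (rule CollectI, rule exI[of _ 1]) simp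

lemma proj_pt_scale:
  assumes "c \<noteq> 0"
  shows "proj_pt (c *s v) = proj_pt v"
proof -
  have "a *s v = (a / c) *s (c *s v)" for a
    using assms by (simp add: vector_smult_assoc)
  then have "\<exists>b. a *s v = b *s (c *s v) \<and> b \<noteq> 0" if "a \<noteq> 0" for a
    using assms that by (metis divide_eq_0_iff)
  moreover have "\<exists>b. a *s (c *s v) = b *s v \<and> b \<noteq> 0" if "a \<noteq> 0" for a
    using assms that by (metis vector_smult_assoc mult_eq_0_iff)
  ultimately show ?thesis
    unfolding proj_pt_def by auto
qed

lemma nonvanishing_proj_pt:
  assumes "homogeneous d H"
  shows "(\<forall>w\<in>proj_pt v. eval3 H w \<noteq> 0) \<longleftrightarrow> eval3 H v \<noteq> 0"
proof
  assume "eval3 H v \<noteq> 0"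
  then show "\<forall>w\<in>proj_pt v. eval3 H w \<noteq> 0"
    using eval3_scale[OF assms] by (auto simp: proj_pt_def)
qed (use proj_pt_self in blast)

lemma vanishing_proj_pt:
  assumes "homogeneous d H" "eval3 H v = 0"
  shows "H \<in> pt_ideal (proj_pt v)"
  using eval3_scale[OF assms(1)] assms(2) by (auto simp: pt_ideal_def proj_pt_def)

text \<open>The variable is prime and does not divide \<open>f\<close>, whose constant term is
  nonzero, so its \<open>n\<close>-th power divides \<open>b\<close> and cancels. The scalar
  \<open>c\<close> may be zero, hence its powers are kept.\<close>

lemma monomial_cancel:
  fixes f :: "'a::idom poly"
  assumes "[:0, c:] ^ n * u = f * b" "poly f 0 \<noteq> 0"
  shows "\<exists>b'. b = [:0, 1:] ^ n * b' \<and> [:c:] ^ n * u = f * b'"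
  using assms(1)
proof (induction n arbitrary: u b)
  case (Suc n)
  have "poly f 0 * poly b 0 = 0"
    using arg_cong[OF Suc.prems, of "\<lambda>p. poly p 0"] by simp
  then have "poly b 0 = 0"
    using assms(2) by simp
  then obtain b' where b: "b = [:0, 1:] * b'"
    by (auto simp: poly_eq_0_iff_dvd dvd_def)
  have "[:0, 1:] * ([:0, c:] ^ n * ([:c:] * u)) = [:0, c:] ^ Suc n * u"
    by (simp add: algebra_simps)
  also have "\<dots> = [:0, 1:] * (f * b')"
    unfolding Suc.prems b by (simp only: mult_ac)
  finally have "[:0, c:] ^ n * ([:c:] * u) = f * b'"
    by (metis mult_left_cancel pCons_eq_0_iff one_neq_zero)
  from Suc.IH[OF this] obtain b'' where "b' = [:0, 1:] ^ n * b''" "[:c:] ^ n * ([:c:] * u) = f * b''"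
    by blast
  then have "b = [:0, 1:] ^ Suc n * b''" "[:c:] ^ Suc n * u = f * b''"
    unfolding b by (simp_all only: power_Suc mult_ac)
  then show ?case
    by blast
qed auto

text \<open>
  Near the smooth point \<open>v\<close> of \<open>F = 0\<close> the maximal ideal is generated by \<open>S = lin v i k\<close> and
  \<open>T = lin v j k\<close>, and \<open>U(v) \<noteq> 0\<close> makes \<open>S\<close> a multiple of \<open>T\<close> modulo \<open>F\<close>: \<open>T\<close> is a uniformizer.
\<close>

locale smooth_point =
  fixes F :: poly3 and v :: "complex ^ 3" and i j k :: 3 and U W :: poly3 and d :: nat
  assumes ijk: "UNIV = {i, j, k}" "i \<noteq> j" "i \<noteq> k" "j \<noteq> k"
    and vk: "v $ k \<noteq> 0"
    and U_form: "homogeneous d U" and W_form: "homogeneous d W"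
    and F_eq: "F = U * lin v i k + W * lin v j k"
    and Uv: "eval3 U v \<noteq> 0"
begin

abbreviation "S \<equiv> lin v i k"
abbreviation "T \<equiv> lin v j k"

text \<open>Since \<open>U * S = F - W * T\<close>, multiplying by \<open>U\<close>, a unit at
  \<open>v\<close>, trades \<open>S\<close> for a multiple of \<open>T\<close> modulo
  \<open>F\<close>. This extracts one factor of the uniformizer.\<close>

lemma form_step:
  assumes "homogeneous e G" "eval3 G v = 0"
  shows "\<exists>e' K B. homogeneous e' K \<and> U * G = T * K + B * F"
proof -
  obtain a b where ab: "homogeneous (e - 1) a" "homogeneous (e - 1) b" "G = a * S + b * T"
    using form_in_lin_ideal[OF ijk(1) vk assms] by blast
  have "U * G = T * (U * b - W * a) + a * F"
    by (simp add: ab F_eq algebra_simps)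
  moreover have "homogeneous (d + (e - 1)) (U * b - W * a)"
    using ab U_form W_form by (intro homogeneous_diff homogeneous_mult)
  ultimately show ?thesis
    by blast
qed

text \<open>Each factor from the ideal of the point yields one \<open>T\<close> at the cost of one
  \<open>U\<close>. The polynomials with this property form an ideal, so checking products
  suffices.\<close>

lemma ideal_pow_step:
  "A \<in> ideal_pow (pt_ideal (proj_pt v)) n \<Longrightarrow> \<exists>L B. U ^ n * A = T ^ n * L + B * F"
proof (induction n arbitrary: A)
  case 0
  have "U ^ 0 * A = T ^ 0 * A + 0 * F"
    by simp
  then show ?case
    by blast
next
  case (Suc n)
  let ?J = "{A. \<exists>L B. U ^ Suc n * A = T ^ Suc n * L + B * F}"
  have "module.subspace (*) ?J"
  proof (rule module.subspaceI[OF module_poly3])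
    have "U ^ Suc n * 0 = T ^ Suc n * 0 + 0 * F"
      by simp
    then show "0 \<in> ?J"
      by blast
  next
    fix x y assume "x \<in> ?J" "y \<in> ?J"
    then obtain L B L' B' where "U ^ Suc n * x = T ^ Suc n * L + B * F"
      "U ^ Suc n * y = T ^ Suc n * L' + B' * F"
      by blast
    then have "U ^ Suc n * (x + y) = T ^ Suc n * (L + L') + (B + B') * F"
      by (simp only: ring_distribs add_ac)
    then show "x + y \<in> ?J"
      by blast
  next
    fix c x assume "x \<in> ?J"
    then obtain L B where "U ^ Suc n * x = T ^ Suc n * L + B * F"
      by blast
    then have "c * (U ^ Suc n * x) = c * (T ^ Suc n * L + B * F)"
      by (simp only:)
    then have "U ^ Suc n * (c * x) = T ^ Suc n * (c * L) + (c * B) * F"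
      by (simp only: ring_distribs mult_ac)
    then show "c * x \<in> ?J"
      by blast
  qed
  moreover have "{a * b | a b. a \<in> pt_ideal (proj_pt v) \<and> b \<in> ideal_pow (pt_ideal (proj_pt v)) n} \<subseteq> ?J"
  proof clarify
    fix a b assume a: "a \<in> pt_ideal (proj_pt v)" and b: "b \<in> ideal_pow (pt_ideal (proj_pt v)) n"
    obtain r s where "a = r * S + s * T"
      using pt_ideal_in_lin_ideal[OF ijk(1) vk a] by blast
    then have Ua: "U * a = T * (U * s - W * r) + r * F"
      by (simp add: F_eq algebra_simps)
    obtain L B where Ub: "U ^ n * b = T ^ n * L + B * F"
      using Suc.IH[OF b] by blast
    have "U ^ Suc n * (a * b) = (U * a) * (U ^ n * b)"
      by (simp add: mult_ac)
    also have "\<dots> = T ^ Suc n * ((U * s - W * r) * L) + (T * (U * s - W * r) * B + r * (U ^ n * b)) * F"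
      unfolding Ua Ub by (simp add: algebra_simps)
    finally show "\<exists>L B. U ^ Suc n * (a * b) = T ^ Suc n * L + B * F"
      by blast
  qed
  ultimately have "module.span (*) {a * b | a b. a \<in> pt_ideal (proj_pt v) \<and>
      b \<in> ideal_pow (pt_ideal (proj_pt v)) n} \<subseteq> ?J"
    by (rule module.span_minimal[OF module_poly3, rotated])
  then show ?case
    using Suc.prems by auto
qed

text \<open>
  \<open>T\<close> is not nilpotent in the local ring: in the coordinates \<open>x\<^sub>i = v\<^sub>i + s\<close>, \<open>x\<^sub>j = v\<^sub>j + t\<close>, \<open>x\<^sub>k = v\<^sub>k\<close> the form \<open>T\<close> becomes a multiple
  of \<open>t\<close>, while \<open>F\<close> is not divisible by \<open>t\<close>.
\<close>

lemma unit_times_power_notin: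
  assumes "T ^ n * u = F * B"
  shows "eval3 u v = 0"
proof -
  have "ring_map (\<lambda>c. [:[:c:]:] :: complex poly poly)"
    by standard (simp_all add: one_pCons)
  \<comment> \<open>The inner polynomial variable is \<open>s\<close> and the outer one is
    \<open>t\<close>, so divisibility by \<open>t\<close> is divisibility by
    \<open>[:0, 1:]\<close>.\<close>
  then obtain \<psi> :: "poly3 \<Rightarrow> complex poly poly" where
    \<psi>: "ring_map \<psi>" "\<And>c. \<psi> (const3 c) = [:[:c:]:]"
    and \<psi>_var: "\<And>l. \<psi> (var l) = (if l = i then [:[:v $ i, 1:]:] else if l = j then [:[:v $ j:], 1:] else [:[:v $ l:]:])"
    using ring_map_poly3_exists[of "\<lambda>c. [:[:c:]:]"
      "\<lambda>l. if l = i then [:[:v $ i, 1:]:] else if l = j then [:[:v $ j:], 1:] else [:[:v $ l:]:]"]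
    by blast
  interpret \<psi>: ring_map \<psi> by fact
  have at_0: "poly (poly (\<psi> G) 0) 0 = eval3 G v" for G
  proof (rule ring_map_poly3_unique[where f = "\<lambda>G. poly (poly (\<psi> G) 0) 0" and g = "\<lambda>G. eval3 G v"])
    show "ring_map (\<lambda>G. poly (poly (\<psi> G) 0) 0)"
      by standard simp_all
  qed (auto simp: ring_map_eval3 \<psi> \<psi>_var)
  have T: "\<psi> T = [:0, [:v $ k:]:]"
    using ijk by (simp add: lin_def \<psi> \<psi>_var)
  have S: "\<psi> S = [:[:0, v $ k:]:]"
    using ijk by (simp add: lin_def \<psi> \<psi>_var)
  have "poly (\<psi> U) 0 \<noteq> 0"
    using at_0[of U] Uv by auto
  \<comment> \<open>At \<open>t = 0\<close> the term with \<open>T\<close> disappears and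
    \<open>F\<close> becomes \<open>U\<close> times the nonzero polynomial
    \<open>v $ k * s\<close>.\<close>
  then have "poly (\<psi> F) 0 \<noteq> 0"
    using vk by (simp add: F_eq S T)
  moreover have "[:0, [:v $ k:]:] ^ n * \<psi> u = \<psi> F * \<psi> B"
    using arg_cong[OF assms, of \<psi>] by (simp add: T)
  ultimately obtain b where "[:[:v $ k:]:] ^ n * \<psi> u = \<psi> F * b"
    using monomial_cancel by blast
  then have "poly (poly ([:[:v $ k:]:] ^ n * \<psi> u) 0) 0 = poly (poly (\<psi> F * b) 0) 0"
    by (simp only:)
  then show ?thesis
    using vk at_0[of F] by (simp add: at_0 F_eq)
qed

text \<open>Exact order \<open>n\<close>: up to the unit \<open>H\<close> and modulo
  \<open>F\<close>, the form \<open>G\<close> is \<open>T ^ n\<close> times the unit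
  \<open>K\<close>. In contrast, \<open>vanishes_to_order\<close> only bounds the order from
  below.\<close>

definition has_order :: "poly3 \<Rightarrow> nat \<Rightarrow> bool" where
  "has_order G n \<longleftrightarrow> (\<exists>e e' H K B. homogeneous e H \<and> homogeneous e' K \<and>
     eval3 H v \<noteq> 0 \<and> eval3 K v \<noteq> 0 \<and> H * G = T ^ n * K + B * F)"

lemma has_orderI:
  "homogeneous e H \<Longrightarrow> homogeneous e' K \<Longrightarrow> eval3 H v \<noteq> 0 \<Longrightarrow> eval3 K v \<noteq> 0 \<Longrightarrow>
    H * G = T ^ n * K + B * F \<Longrightarrow> has_order G n"
  unfolding has_order_def by blast

lemma has_order_mult:
  assumes "has_order G m" "has_order G' n"
  shows "has_order (G * G') (m + n)"
proof -
  obtain e e' H K B where 1: "homogeneous e H" "homogeneous e' K"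
    "eval3 H v \<noteq> 0" "eval3 K v \<noteq> 0" "H * G = T ^ m * K + B * F"
    using assms(1) unfolding has_order_def by blast
  obtain f f' H' K' B' where 2: "homogeneous f H'" "homogeneous f' K'"
    "eval3 H' v \<noteq> 0" "eval3 K' v \<noteq> 0" "H' * G' = T ^ n * K' + B' * F"
    using assms(2) unfolding has_order_def by blast
  have "(H * H') * (G * G') = (H * G) * (H' * G')"
    by (simp add: mult_ac)
  also have "\<dots> = T ^ (m + n) * (K * K') + (T ^ m * K * B' + B * (H' * G')) * F"
    unfolding 1 2 by (simp add: algebra_simps power_add)
  finally show ?thesis
    using 1 2 by (intro has_orderI[OF homogeneous_mult homogeneous_mult]) auto
qed

lemma T_power_in_ideal: "T ^ n * K \<in> ideal_pow (pt_ideal (proj_pt v)) n"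
proof -
  have "T \<in> pt_ideal (proj_pt v)"
    by (intro vanishing_proj_pt[OF homogeneous_lin]) simp
  then show ?thesis
    using ideal_pow_mult[OF power_in_ideal_pow] by (metis mult.commute)
qed

text \<open>If \<open>G\<close> also vanished to an order \<open>n > m\<close>, comparing the two
  relations would make \<open>T ^ m\<close> times some polynomial a multiple of \<open>F\<close>. By
  \<open>unit_times_power_notin\<close> that polynomial vanishes at \<open>v\<close>, yet its value
  there is that of \<open>U ^ n * H' * K\<close>, a product of nonzero factors.\<close>

lemma ord_at_eqI:
  assumes "has_order G m"
  shows "ord_at F (proj_pt v) G = enat m"
proof -
  obtain e e' H K B where 1: "homogeneous e H" "homogeneous e' K"
    "eval3 H v \<noteq> 0" "eval3 K v \<noteq> 0" "H * G = T ^ m * K + B * F"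
    using assms(1) unfolding has_order_def by blast
  have "vanishes_to_order F (proj_pt v) G m"
    unfolding vanishes_to_order_def using 1 nonvanishing_proj_pt[OF 1(1)] T_power_in_ideal by blast
  moreover have "n \<le> m" if vanishes: "vanishes_to_order F (proj_pt v) G n" for n
  proof (rule ccontr)
    assume "\<not> n \<le> m"
    then obtain r where n: "n = m + Suc r"
      by (metis add_Suc_right less_imp_Suc_add not_le)
    obtain f H' A B' where 2: "homogeneous f H'" "\<forall>w\<in>proj_pt v. eval3 H' w \<noteq> 0"
      "A \<in> ideal_pow (pt_ideal (proj_pt v)) n" "H' * G = A + B' * F"
      using vanishes unfolding vanishes_to_order_def by blast
    have H': "eval3 H' v \<noteq> 0"
      using 2 nonvanishing_proj_pt by blast
    obtain L B'' where 3: "U ^ n * A = T ^ n * L + B'' * F"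
      using ideal_pow_step[OF 2(3)] by blast
    \<comment> \<open>\<open>U ^ n * H' * H * G\<close> is computed from each of the two
      relations.\<close>
    have "U ^ n * H' * (T ^ m * K + B * F) = H * (U ^ n * (H' * G))"
      unfolding 1(5)[symmetric] by (simp only: mult_ac)
    also have "\<dots> = H * (T ^ n * L + B'' * F + U ^ n * B' * F)"
      unfolding 2(4) 3[symmetric] by (simp only: ring_distribs mult_ac)
    finally have "U ^ n * H' * (T ^ m * K + B * F) - H * (T ^ n * L + B'' * F + U ^ n * B' * F) = 0"
      by simp
    moreover have "T ^ m * (U ^ n * H' * K - H * T ^ Suc r * L) - F * (H * B'' + H * U ^ n * B' - U ^ n * H' * B)
        = U ^ n * H' * (T ^ m * K + B * F) - H * (T ^ n * L + B'' * F + U ^ n * B' * F)"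
      by (simp add: n power_add algebra_simps)
    ultimately have "T ^ m * (U ^ n * H' * K - H * T ^ Suc r * L) =
        F * (H * B'' + H * U ^ n * B' - U ^ n * H' * B)"
      by simp
    then have "eval3 (U ^ n * H' * K - H * T ^ Suc r * L) v = 0"
      by (rule unit_times_power_notin)
    then show False
      using 1 H' Uv by simp
  qed
  ultimately show ?thesis
    unfolding ord_at_def by (intro antisym Sup_least Sup_upper) auto
qed

text \<open>Factors \<open>T\<close> are extracted by \<open>form_step\<close> as long as the
  cofactor vanishes at \<open>v\<close>. Order \<open>n\<close> excludes \<open>n + 1\<close>
  extractions, so the process stops at an exact order, which \<open>ord_at_eqI\<close> identifies
  with \<open>n\<close>.\<close>

lemma ord_at_finiteD:
  assumes "homogeneous e G" "ord_at F (proj_pt v) G = enat n"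
  shows "has_order G n"
proof -
  have alt: "(\<exists>m<n. has_order G m) \<or>
      (\<exists>f e' H K B. homogeneous f H \<and> homogeneous e' K \<and> eval3 H v \<noteq> 0 \<and> H * G = T ^ n * K + B * F)" for n
  proof (induction n)
    case 0
    have "1 * G = T ^ 0 * G + 0 * F"
      by simp
    then show ?case
      using assms(1) homogeneous_1 by (metis eval3_simps(2) one_neq_zero)
  next
    case (Suc n)
    show ?case
    proof (cases "\<exists>m<Suc n. has_order G m")
      case False
      then obtain f e' H K B where *: "homogeneous f H" "homogeneous e' K" "eval3 H v \<noteq> 0"
        "H * G = T ^ n * K + B * F"
        using Suc.IH less_Suc_eq by blast
      moreover have "\<not> has_order G n"
        using False by blast
      ultimately have "eval3 K v = 0"
        using has_orderI by blast
      then obtain g K' B' where K': "homogeneous g K'" "U * K = T * K' + B' * F"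
        using form_step[OF *(2)] by blast
      have "(U * H) * G = T ^ n * (U * K) + U * B * F"
        using *(4) by (simp only: mult.assoc ring_distribs) (simp only: mult_ac)
      also have "\<dots> = T ^ Suc n * K' + (T ^ n * B' + U * B) * F"
        unfolding K' by (simp add: algebra_simps)
      finally show ?thesis
        using homogeneous_mult[OF U_form *(1)] K' * Uv by (metis eval3_simps(4) mult_eq_0_iff)
    qed auto
  qed
  obtain m where "has_order G m"
  proof -
    have "\<not> vanishes_to_order F (proj_pt v) G (Suc n)"
    proof
      assume "vanishes_to_order F (proj_pt v) G (Suc n)"
      then have "enat (Suc n) \<le> ord_at F (proj_pt v) G"
        unfolding ord_at_def by (intro Sup_upper) blast
      then show False
        using assms(2) by simp
    qed
    then have "\<not> (\<exists>f e' H K B. homogeneous f H \<and> homogeneous e' K \<and> eval3 H v \<noteq> 0 \<and>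
        H * G = T ^ Suc n * K + B * F)"
      unfolding vanishes_to_order_def using nonvanishing_proj_pt T_power_in_ideal by blast
    then show ?thesis
      using alt[of "Suc n"] that by blast
  qed
  with ord_at_eqI[OF this] assms(2) show ?thesis
    by simp
qed

lemma ord_at_mult:
  assumes "homogeneous e G" "homogeneous f H"
    and "ord_at F (proj_pt v) G = enat m" "ord_at F (proj_pt v) H = enat n"
  shows "ord_at F (proj_pt v) (G * H) = enat (m + n)"
  using ord_at_eqI[OF has_order_mult] ord_at_finiteD assms by blast

section \<open>The tangent line at a smooth point\<close>

lemma eval3_dvar_F: "eval3 (dvar l F) v = eval3 U v * ((if l = i then v $ k else 0) - (if l = k then v $ i else 0))
    + eval3 W v * ((if l = j then v $ k else 0) - (if l = k then v $ j else 0))"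
proof -
  have "dvar l (lin v a k) = const3 (v $ k) * (if l = a then 1 else 0) - const3 (v $ a) * (if l = k then 1 else 0)" for a
    by (simp add: lin_def dvar_diff)
  then show ?thesis
    by (simp add: F_eq)
qed

text \<open>\<open>S\<close> and \<open>T\<close> vanish at \<open>v\<close>, so the derivatives of
  \<open>F = U * S + W * T\<close> there see \<open>U\<close> and \<open>W\<close> only through
  their values at \<open>v\<close>.\<close>

lemma eval3_tangent_line:
  "eval3 (tangent_line F v) w = eval3 U v * eval3 S w + eval3 W v * eval3 T w"
proof -
  have "eval3 (tangent_line F v) w = (\<Sum>l\<in>UNIV. eval3 (dvar l F) v * w $ l)"
    by (simp add: tangent_line_def sum_3)
  also have "\<dots> = (\<Sum>l\<in>{i, j, k}. eval3 (dvar l F) v * w $ l)"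
    by (simp add: ijk(1))
  also have "\<dots> = eval3 U v * eval3 S w + eval3 W v * eval3 T w"
    using ijk(2-4) by (simp add: eval3_dvar_F algebra_simps)
  finally show ?thesis .
qed

text \<open>
  Order 4 gives \<open>H L = T\<^sup>4 K + B F\<close>, where \<open>B(v) \<noteq> 0\<close> by comparing first derivatives at \<open>v\<close>.
  Restricted to the points \<open>v + t w\<close> of \<open>L = 0\<close> this shows that \<open>F(v + t w)\<close> is divisible by
  \<open>t\<^sup>4\<close>. Its degree in \<open>t\<close> is at most 4 with leading coefficient \<open>F(w) = 0\<close>, so it vanishes, and
  then so does \<open>T(w)\<close>.
\<close>

lemma tangent_line_meets_at_v:
  assumes F4: "homogeneous 4 F" and ord: "ord_at F (proj_pt v) (tangent_line F v) = 4"
    and w: "eval3 F w = 0" "eval3 (tangent_line F v) w = 0"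
  shows "eval3 S w = 0 \<and> eval3 T w = 0"
proof -
  let ?L = "tangent_line F v"
  have "homogeneous 1 ?L"
    unfolding tangent_line_def
    using homogeneous_var[of 1] homogeneous_var[of 2] homogeneous_var[of 3]
    by (intro homogeneous_add homogeneous_const3_mult) simp_all
  moreover have "ord_at F (proj_pt v) ?L = enat 4"
    using ord by (simp add: numeral_eq_enat)
  ultimately have "has_order ?L 4"
    by (rule ord_at_finiteD)
  then obtain H K B where H: "eval3 H v \<noteq> 0" and K: "eval3 K v \<noteq> 0"
    and eq: "H * ?L = T ^ 4 * K + B * F"
    unfolding has_order_def by blast
  have Lv: "eval3 ?L v = 0"
    by (simp add: eval3_tangent_line)
  have Fv: "eval3 F v = 0"
    by (simp add: F_eq)
  \<comment> \<open>The direction \<open>i\<close> is chosen because the derivative of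
    \<open>F\<close> at \<open>v\<close> in it is \<open>U(v) * v $ k\<close>, which is nonzero; the
    term with \<open>T ^ 4\<close> contributes nothing.\<close>
  have "dvar i ?L = const3 (eval3 (dvar i F) v)"
    using exhaust_3[of i] dvar_var[of i 1] dvar_var[of i 2] dvar_var[of i 3]
    by (auto simp: tangent_line_def simp del: dvar_var)
  then have "eval3 (dvar i (H * ?L)) v = eval3 H v * eval3 (dvar i F) v"
    using Lv by simp
  moreover have "eval3 (dvar i (T ^ 4 * K + B * F)) v = eval3 B v * eval3 (dvar i F) v"
    using Fv by (simp add: power_Suc numeral_eq_Suc)
  moreover have "eval3 (dvar i F) v \<noteq> 0"
    using Uv vk ijk by (simp add: eval3_dvar_F)
  ultimately have Bv: "eval3 B v \<noteq> 0"
    using H unfolding eq by auto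
  have "ring_map (\<lambda>c. [:c:] :: complex poly)"
    by standard (simp_all add: one_pCons)
  then obtain \<rho> :: "poly3 \<Rightarrow> complex poly" where
    \<rho>: "ring_map \<rho>" "\<And>c. \<rho> (const3 c) = [:c:]" "\<And>l. \<rho> (var l) = [:v $ l, w $ l:]"
    using ring_map_poly3_exists[of "\<lambda>c. [:c:]" "\<lambda>l. [:v $ l, w $ l:]"] by blast
  interpret \<rho>: ring_map \<rho> by fact
  have \<rho>_XYZ: "\<rho> varX = [:v $ 1, w $ 1:]" "\<rho> varY = [:v $ 2, w $ 2:]" "\<rho> varZ = [:v $ 3, w $ 3:]"
    using \<rho>(3)[of 1] \<rho>(3)[of 2] \<rho>(3)[of 3] by simp_all
  have at_0: "poly (\<rho> G) 0 = eval3 G v" for G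
  proof (rule ring_map_poly3_unique[where f = "\<lambda>G. poly (\<rho> G) 0" and g = "\<lambda>G. eval3 G v"])
    show "ring_map (\<lambda>G. poly (\<rho> G) 0)"
      by standard simp_all
  qed (auto simp: ring_map_eval3 \<rho>)
  have top: "degree (\<rho> F) \<le> 4 \<and> poly.coeff (\<rho> F) 4 = eval3 F w"
    using F4
  proof (induction rule: homogeneous_induct)
    case (add G G')
    then show ?case
      by (simp add: degree_add_le)
  next
    case (monomial i' j' k' c)
    have step: "degree ([:a, b:] ^ n * p) \<le> n + m \<and> poly.coeff ([:a, b:] ^ n * p) (n + m) = b ^ n * c"
      if "degree p \<le> m \<and> poly.coeff p m = c" for a b c :: complex and p n m
    proof (induction n)
      case (Suc n)
      let ?q = "[:a, b:] ^ n * p"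
      have "degree ([:a, b:] * ?q) \<le> degree [:a, b:] + degree ?q"
        by (rule degree_mult_le)
      also have "\<dots> \<le> 1 + (n + m)"
        using Suc by (intro add_mono) auto
      finally have "degree ([:a, b:] * ?q) \<le> Suc n + m"
        by simp
      moreover have "poly.coeff ?q (Suc (n + m)) = 0"
        using Suc by (intro coeff_eq_0) simp
      then have "poly.coeff ([:a, b:] * ?q) (Suc n + m) = b ^ Suc n * c"
        using Suc by simp
      ultimately show ?case
        by (simp only: power_Suc mult.assoc)
    qed (use that in simp)
    have "degree [:c:] \<le> 0 \<and> poly.coeff [:c:] 0 = c"
      by simp
    from step[OF step[OF step[OF this, of "v $ 1" "w $ 1" i'], of "v $ 2" "w $ 2" j'], of "v $ 3" "w $ 3" k']
    show ?case
      using monomial by (simp add: \<rho>_XYZ \<rho>(2) mult_ac add_ac)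
  qed simp
  have "\<rho> ?L = [:eval3 ?L v, eval3 ?L w:]"
    by (simp add: tangent_line_def \<rho>_XYZ \<rho>(2))
  then have "\<rho> ?L = 0"
    using Lv w by simp
  moreover have "\<rho> T = [:0, eval3 T w:]"
    by (simp add: lin_def \<rho>)
  ultimately have "[:0, eval3 T w:] ^ 4 * \<rho> K + \<rho> B * \<rho> F = 0"
    using arg_cong[OF eq, of \<rho>] by simp
  then have "[:0, eval3 T w:] ^ 4 * (- \<rho> K) = \<rho> B * \<rho> F"
    by (simp only: mult_minus_right neg_eq_iff_add_eq_0)
  moreover have "poly (\<rho> B) 0 \<noteq> 0"
    using Bv at_0 by simp
  ultimately obtain b where b: "\<rho> F = [:0, 1:] ^ 4 * b" "[:eval3 T w:] ^ 4 * (- \<rho> K) = \<rho> B * b"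
    using monomial_cancel by blast
  have "b = 0"
  proof (rule ccontr)
    assume "b \<noteq> 0"
    then have "degree (\<rho> F) = 4 + degree b"
      unfolding b(1) by (simp add: degree_mult_eq degree_power_eq)
    then have "degree b = 0"
      using top by simp
    moreover have "poly.coeff (\<rho> F) 4 = poly.coeff b 0"
      unfolding b(1) by (simp add: numeral_eq_Suc)
    ultimately show False
      using top w \<open>b \<noteq> 0\<close> by (metis leading_coeff_neq_0)
  qed
  moreover have "\<rho> K \<noteq> 0"
    using K at_0[of K] by auto
  ultimately have "eval3 T w = 0"
    using b(2) by simp
  moreover have "eval3 S w = 0"
    using w(2) calculation Uv unfolding eval3_tangent_line by simp
  ultimately show ?thesis
    by blast
qed

end

text \<open>In a chart with \<open>v $ k\<close> nonzero, \<open>F\<close> is a combination of the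
  two linear forms through \<open>v\<close>. If both coefficients vanished at \<open>v\<close>, so
  would every derivative of \<open>F\<close>; the roles of \<open>i\<close> and \<open>j\<close> are
  exchanged if only the second coefficient is known to be nonzero.\<close>

lemma smooth_point_exists:
  assumes F: "homogeneous d F" and v: "v \<noteq> 0" "eval3 F v = 0" and l: "eval3 (dvar l F) v \<noteq> 0"
  shows "\<exists>i j k U W e. smooth_point F v i j k U W e"
proof -
  obtain k where k: "v $ k \<noteq> 0"
    using v by (metis vec_eq_iff zero_index)
  obtain i j where ij: "UNIV = {i, j, k}" "i \<noteq> j" "i \<noteq> k" "j \<noteq> k"
  proof -
    have 1: "(UNIV :: 3 set) = {2, 3, 1}" and 2: "(UNIV :: 3 set) = {1, 3, 2}"
      and 3: "(UNIV :: 3 set) = {1, 2, 3}"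
      using UNIV_3 by auto
    consider "k = 1" | "k = 2" | "k = 3"
      using exhaust_3[of k] by blast
    then show ?thesis
    proof cases
      assume "k = 1" then show ?thesis by (intro that[of 2 3]) (simp_all add: 1[symmetric])
    next
      assume "k = 2" then show ?thesis by (intro that[of 1 3]) (simp_all add: 2[symmetric])
    next
      assume "k = 3" then show ?thesis by (intro that[of 1 2]) (simp_all add: 3[symmetric])
    qed
  qed
  obtain a b where ab: "homogeneous (d - 1) a" "homogeneous (d - 1) b"
    and F_eq: "F = a * lin v i k + b * lin v j k"
    using form_in_lin_ideal[OF ij(1) k F v(2)] by blast
  have "eval3 (dvar l F) v = eval3 a v * eval3 (dvar l (lin v i k)) v + eval3 b v * eval3 (dvar l (lin v j k)) v"
    by (simp add: F_eq)
  then consider "eval3 a v \<noteq> 0" | "eval3 b v \<noteq> 0"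
    using l by (metis add.right_neutral mult_zero_left)
  then show ?thesis
  proof cases
    case 1
    then have "smooth_point F v i j k a b (d - 1)"
      by (intro smooth_point.intro ij k ab F_eq)
    then show ?thesis
      by blast
  next
    case 2
    have "UNIV = {j, i, k}" "F = b * lin v j k + a * lin v i k"
      using ij(1) F_eq by (simp_all only: insert_commute add.commute)
    with 2 have "smooth_point F v j i k b a (d - 1)"
      by (intro smooth_point.intro ij ij(2)[symmetric] k ab)
    then show ?thesis
      by blast
  qed
qed

section \<open>Divisors and their classes\<close>

lemma curve_pts_smooth_point:
  assumes "homogeneous d F" "nonsingular F" "P \<in> curve_pts F"
  obtains v i j k U W e where "P = proj_pt v" "v \<noteq> 0" "smooth_point F v i j k U W e"
proof -
  obtain v where v: "P = proj_pt v" "v \<noteq> 0" "eval3 F v = 0"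
    using assms(3) proj_pt_self by (auto simp: curve_pts_def P2_def)
  have "\<exists>l. eval3 (dvar l F) v \<noteq> 0"
    using assms(2) v unfolding nonsingular_def by (metis dvar_simps)
  then show ?thesis
    using smooth_point_exists[OF assms(1) v(2,3)] that v by blast
qed

text \<open>Orders add at each point, and effectiveness makes \<open>nat\<close> additive on the
  coefficients.\<close>

lemma cuts_out_mult:
  assumes F: "homogeneous d F" "nonsingular F"
    and forms: "homogeneous e G" "homogeneous f H"
    and cuts: "cuts_out F G \<Delta>" "cuts_out F H \<Delta>'"
  shows "cuts_out F (G * H) (\<Delta> + \<Delta>')"
  unfolding cuts_out_def
proof (intro conjI ballI)
  have eff: "effective F \<Delta>" "effective F \<Delta>'"
    using cuts by (auto simp: cuts_out_def)
  then show "effective F (\<Delta> + \<Delta>')"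
    using keys_add[of \<Delta> \<Delta>']
    by (auto simp: effective_def free_Abelian_group_def lookup_add)
  fix P assume P: "P \<in> curve_pts F"
  then obtain v i j k U W e' where v: "P = proj_pt v" "smooth_point F v i j k U W e'"
    using curve_pts_smooth_point[OF F] by metis
  have "ord_at F P (G * H) =
      enat (nat (Poly_Mapping.lookup \<Delta> P) + nat (Poly_Mapping.lookup \<Delta>' P))"
    using cuts P unfolding cuts_out_def v(1)
    by (intro smooth_point.ord_at_mult[OF v(2) forms]) auto
  then show "ord_at F P (G * H) = enat (nat (Poly_Mapping.lookup (\<Delta> + \<Delta>') P))"
    using eff by (simp add: effective_def lookup_add nat_add_distrib)
qed

text \<open>A multiple of \<open>F\<close> vanishes to every order at \<open>P\<close>. A point must
  be given because \<open>cuts_out\<close> restricts orders only at points of the curve.\<close>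

lemma cuts_out_not_dvd:
  assumes "cuts_out F G \<Delta>" "P \<in> curve_pts F"
  shows "\<not> F dvd G"
proof
  assume "F dvd G"
  then obtain B where B: "G = F * B" ..
  have "vanishes_to_order F P G n" for n
    unfolding vanishes_to_order_def
  proof (intro exI conjI)
    show "homogeneous 0 1" "\<forall>v\<in>P. eval3 1 v \<noteq> 0" "1 * G = 0 + B * F"
      using B by (auto simp: mult.commute)
    show "0 \<in> ideal_pow (pt_ideal P) n"
      by (cases n) (auto intro: module.span_zero[OF module_poly3])
  qed
  then have "enat n \<le> ord_at F P G" for n
    unfolding ord_at_def by (intro Sup_upper) blast
  moreover obtain m where "ord_at F P G = enat m"
    using assms by (auto simp: cuts_out_def)
  ultimately have "enat (Suc m) \<le> enat m"
    by metis
  then show False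
    by simp
qed

text \<open>The order at \<open>p\<close> is 4 by the hyper-flex condition. At any other point the
  tangent line does not vanish, by \<open>tangent_line_meets_at_v\<close>, so no intersection count
  is involved.\<close>

lemma cuts_out_tangent_line:
  assumes F: "homogeneous 4 F" "nonsingular F" and flex: "hyperflex F p"
  obtains L where "homogeneous 1 L" "cuts_out F L (frag_cmul 4 (frag_of p))"
proof -
  have p: "p \<in> curve_pts F"
    using flex by (simp add: hyperflex_def)
  then obtain v i j k U W e where v: "p = proj_pt v" "v \<noteq> 0" "smooth_point F v i j k U W e"
    using curve_pts_smooth_point[OF F] by metis
  interpret smooth_point F v i j k U W e by fact
  let ?L = "tangent_line F v"
  have L: "homogeneous 1 ?L"
    unfolding tangent_line_def
    using homogeneous_var[of 1] homogeneous_var[of 2] homogeneous_var[of 3]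
    by (intro homogeneous_add homogeneous_const3_mult) simp_all
  have ord: "ord_at F p ?L = 4"
    using flex proj_pt_self v(1) by (auto simp: hyperflex_def)
  have "ord_at F Q ?L = enat (nat (Poly_Mapping.lookup (frag_cmul 4 (frag_of p)) Q))"
    if Q: "Q \<in> curve_pts F" for Q
  proof (cases "Q = p")
    case True
    then show ?thesis
      using ord by (simp add: numeral_eq_enat)
  next
    case False
    obtain w i' j' k' U' W' e' where w: "Q = proj_pt w" "w \<noteq> 0" "smooth_point F w i' j' k' U' W' e'"
      using curve_pts_smooth_point[OF F Q] by metis
    have Fw: "eval3 F w = 0"
      using Q w proj_pt_self by (auto simp: curve_pts_def)
    have "eval3 ?L w \<noteq> 0"
    proof
      assume "eval3 ?L w = 0"
      then have "eval3 S w = 0" "eval3 T w = 0"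
        using tangent_line_meets_at_v F(1) ord Fw v(1) by blast+
      \<comment> \<open>For \<open>l = i\<close> and \<open>l = j\<close> this is the vanishing of
        \<open>S\<close> and \<open>T\<close> at \<open>w\<close>; for \<open>l = k\<close> it is
        trivial.\<close>
      then have eq: "v $ k * w $ l = w $ k * v $ l" for l
        using ijk(1) by (cases "l = k"; cases "l = i") (auto simp: mult.commute)
      then have "w = (w $ k / v $ k) *s v"
        using vk by (simp add: vec_eq_iff field_simps)
      moreover from this have "w $ k / v $ k \<noteq> 0"
        using w(2) by auto
      ultimately show False
        using False v(1) w(1) proj_pt_scale by metis
    qed
    \<comment> \<open>The line is itself a unit at \<open>w\<close>: take \<open>H = 1\<close> and
      \<open>K\<close> the line.\<close>
    then have "smooth_point.has_order F w j' k' ?L 0"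
      by (intro smooth_point.has_orderI[OF w(3) homogeneous_1 L, where B = 0]) simp_all
    then have "ord_at F Q ?L = enat 0"
      using smooth_point.ord_at_eqI[OF w(3)] w(1) by simp
    then show ?thesis
      using False by (simp add: keys_frag_of)
  qed
  moreover have "effective F (frag_cmul 4 (frag_of p))"
    using p by (auto simp: effective_def free_Abelian_group_def keys_frag_of)
  ultimately have "cuts_out F ?L (frag_cmul 4 (frag_of p))"
    by (auto simp: cuts_out_def)
  with L that show ?thesis
    by blast
qed

text \<open>Numerators and denominators are multiplied. That \<open>F\<close> divides neither
  product follows from the divisors they cut out, given a point on the curve, rather than from
  primality of \<open>F\<close>.\<close>

lemma principal_divisors_add:
  assumes F: "homogeneous d F" "nonsingular F" "curve_pts F \<noteq> {}"
    and "D \<in> principal_divisors F" "D' \<in> principal_divisors F"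
  shows "D + D' \<in> principal_divisors F"
proof -
  obtain \<Delta> \<Delta>' e G H where 1: "D = \<Delta> - \<Delta>'" "homogeneous e G" "homogeneous e H"
    "cuts_out F G \<Delta>" "cuts_out F H \<Delta>'"
    using assms(4) unfolding principal_divisors_def by blast
  obtain \<Gamma> \<Gamma>' e' G' H' where 2: "D' = \<Gamma> - \<Gamma>'" "homogeneous e' G'" "homogeneous e' H'"
    "cuts_out F G' \<Gamma>" "cuts_out F H' \<Gamma>'"
    using assms(5) unfolding principal_divisors_def by blast
  have "cuts_out F (G * G') (\<Delta> + \<Gamma>)" "cuts_out F (H * H') (\<Delta>' + \<Gamma>')"
    using 1 2 cuts_out_mult[OF F(1,2)] by blast+
  moreover have "homogeneous (e + e') (G * G')" "homogeneous (e + e') (H * H')"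
    using 1 2 homogeneous_mult by blast+
  moreover have "D + D' = (\<Delta> + \<Gamma>) - (\<Delta>' + \<Gamma>')"
    using 1 2 by simp
  ultimately show ?thesis
    using cuts_out_not_dvd F(3) unfolding principal_divisors_def by blast
qed

lemma principal_divisors_uminus:
  assumes "D \<in> principal_divisors F"
  shows "- D \<in> principal_divisors F"
proof -
  obtain \<Delta> \<Delta>' e G H where "D = \<Delta> - \<Delta>'" "homogeneous e G" "homogeneous e H"
    "\<not> F dvd G" "\<not> F dvd H" "cuts_out F G \<Delta>" "cuts_out F H \<Delta>'"
    using assms unfolding principal_divisors_def by blast
  moreover from this have "- D = \<Delta>' - \<Delta>"
    by simp
  ultimately show ?thesis
    unfolding principal_divisors_def by blast
qed

text \<open>Zero arises as \<open>D + - D\<close> from a principal divisor already at hand.\<close>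

lemma principal_divisors_0:
  assumes F: "homogeneous d F" "nonsingular F" "curve_pts F \<noteq> {}"
    and "D \<in> principal_divisors F"
  shows "0 \<in> principal_divisors F"
  using principal_divisors_add[OF F assms(4) principal_divisors_uminus[OF assms(4)]] by simp

text \<open>The product of the two cosets consists of sums of representatives, and shifting by the
  principal divisor \<open>D + D' - E\<close> matches these with the coset of
  \<open>E\<close>.\<close>

lemma jac_class_mult:
  assumes F: "homogeneous d F" "nonsingular F" "curve_pts F \<noteq> {}"
    and eq: "D + D' - E \<in> principal_divisors F"
  shows "jac_class F D \<otimes>\<^bsub>jacobian F\<^esub> jac_class F D' = jac_class F E"
proof -
  let ?N = "principal_divisors F"
  have jac_class_eq: "jac_class F D = {h + D | h. h \<in> ?N}" for D
    by (auto simp: jac_class_def r_coset_def Div0_def free_Abelian_group_def)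
  have "jac_class F D \<otimes>\<^bsub>jacobian F\<^esub> jac_class F D' = {(h + D) + (h' + D') | h h'. h \<in> ?N \<and> h' \<in> ?N}"
    unfolding jac_class_eq
    by (auto simp: jacobian_def FactGroup_def set_mult_def Div0_def free_Abelian_group_def)
  also have "\<dots> = {h + E | h. h \<in> ?N}"
  proof (intro equalityI subsetI; clarify)
    fix h h' assume "h \<in> ?N" "h' \<in> ?N"
    then have "h + h' + (D + D' - E) \<in> ?N"
      using principal_divisors_add[OF F] eq by blast
    moreover have "(h + D) + (h' + D') = h + h' + (D + D' - E) + E"
      by (simp add: algebra_simps)
    ultimately show "\<exists>g. (h + D) + (h' + D') = g + E \<and> g \<in> ?N"
      by blast
  next
    fix h assume "h \<in> ?N"
    then have "h + - (D + D' - E) \<in> ?N"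
      using principal_divisors_add[OF F] principal_divisors_uminus eq by blast
    \<comment> \<open>The first representative takes the whole correction, the second takes the
      principal divisor 0.\<close>
    moreover have "h + E = (h + - (D + D' - E) + D) + (0 + D')"
      by (simp add: algebra_simps)
    ultimately show "\<exists>g g'. h + E = (g + D) + (g' + D') \<and> g \<in> ?N \<and> g' \<in> ?N"
      using principal_divisors_0[OF F eq] by blast
  qed
  finally show ?thesis
    unfolding jac_class_eq .
qed

theorem mainTheorem4:
  fixes F C A :: poly3 and p :: pt and D D' E Em :: divisor
  assumes "plane_curve 4 F" and "nonsingular F" and "hyperflex F p"
    and "effective F D" and "div_degree D = 3"
    and "effective F D'" and "div_degree D' = 3"
    and "effective F Em" and "div_degree Em = 3"
    and "effective F E" and "div_degree E = 3"
    and "plane_curve 3 C"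
    and "cuts_out F C (D + D' + Em + frag_cmul 3 (frag_of p))"
    and "plane_curve 2 A"
    and "cuts_out F A (Em + E + frag_cmul 2 (frag_of p))"
  shows "jac_class F (D - frag_cmul 3 (frag_of p)) \<otimes>\<^bsub>jacobian F\<^esub>
           jac_class F (D' - frag_cmul 3 (frag_of p))
         = jac_class F (E - frag_cmul 3 (frag_of p))
         \<and> lin_equiv F ((D - frag_cmul 3 (frag_of p)) + (D' - frag_cmul 3 (frag_of p)))
           (E - frag_cmul 3 (frag_of p))"
proof -
  have F: "homogeneous 4 F" "homogeneous 3 C" "homogeneous 2 A"
    using assms by (auto simp: plane_curve_def)
  have p: "p \<in> curve_pts F"
    using assms(3) by (simp add: hyperflex_def)
  let ?p = "\<lambda>n. frag_cmul n (frag_of p)"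
  obtain L where L: "homogeneous 1 L" "cuts_out F L (?p 4)"
    using cuts_out_tangent_line[OF F(1) assms(2,3)] .
  have "cuts_out F (A * L) (Em + E + ?p 2 + ?p 4)"
    using cuts_out_mult[OF F(1) assms(2) F(3) L(1) assms(15) L(2)] .
  \<comment> \<open>A conic times a line has the degree of \<open>C\<close>, as numerator and
    denominator of a rational function must.\<close>
  moreover have "homogeneous 3 (A * L)"
    using homogeneous_mult[OF F(3) L(1)] by simp
  \<comment> \<open>\<open>Em\<close> cancels, and the multiples of \<open>p\<close> agree: -3 - 3 +
    3 = 3 - 2 - 4.\<close>
  moreover have "(D - ?p 3) + (D' - ?p 3) - (E - ?p 3) =
      (D + D' + Em + ?p 3) - (Em + E + ?p 2 + ?p 4)"
    by (rule poly_mapping_eqI) (simp add: lookup_add lookup_minus)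
  ultimately have principal: "(D - ?p 3) + (D' - ?p 3) - (E - ?p 3) \<in> principal_divisors F"
    using cuts_out_not_dvd[OF _ p] assms(13) F(2) unfolding principal_divisors_def by blast
  have "Poly_Mapping.keys (?p 3) \<subseteq> curve_pts F"
    using p by (auto simp: keys_frag_of)
  then have carrier: "B - ?p 3 \<in> carrier (Div F)" if "effective F B" for B
    using that keys_diff[of B "?p 3"] by (auto simp: effective_def free_Abelian_group_def)
  then have "(D - ?p 3) + (D' - ?p 3) \<in> carrier (Div F)"
    using assms(4,6) keys_add[of "D - ?p 3" "D' - ?p 3"]
    by (fastforce simp: free_Abelian_group_def)
  then show ?thesis
    using jac_class_mult[OF F(1) assms(2) _ principal] carrier[OF assms(10)] principal p
    by (auto simp: lin_equiv_def)
qed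

end
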